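(* Let $p$ be an odd positive integer, and let $\Phi=\mathcal S_p^{(\delta t)}$ and $\Psi=\mathcal S_p^{(m\delta t)}$. Suppose that neither the fine-grid CFL number $\alpha\delta t/h$ nor the coarse-grid CFL number $m\alpha\delta t/h$ is an integer. Then asymptotically smooth Fourier modes receive a coarse-grid correction that is order $p+1$ small in $\omega$ if they are not characteristic components, while asymptotically smooth characteristic components receive an order zero coarse-grid correction in $\omega$: $$\left.\frac{\big|\widetilde A_1(\omega,m\theta)-\widetilde A_1^{\rm ideal}(\omega,m\theta)\big|}{\big|\widetilde A_1(\omega,m\theta)\big|}\right|_{\omega=\mathcal O(h)}=\begin{cases}\mathcal O(\omega^{p+1}), & \theta\not\approx-\dfrac{\omega\alpha\delta t}{h},\\[2ex] \mathcal O(1), & \theta\approx-\dfrac{\omega\alpha\delta t}{h}.\end{cases}$$ Precisely: for all $K,\delta>0$ there exist $C,h_0>0$ such that for all $0<h\le h_0$, all $\omega$ with $0<|\omega|\le Kh$, and all $\theta\in[-\pi/m,\pi/m)$, the ratio on the left is at most $C|\omega|^{p+1}$ if $|\theta+\omega\alpha\delta t/h|\ge\delta$, and at most $C$ if $|\theta+\omega\alpha\delta t/h|<\delta$.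
   Context: Consider the advection equation $u_t+\alpha u_x=0$, $\alpha>0$, with periodic boundary conditions in space, on an equispaced spatial mesh with $n_x$ points $x_i$ and spacing $h$. Let $m\ge2$ be the MGRIT coarsening factor and $\delta t>0$ the fine time step. The CFL number $c=\alpha\delta t/h$ is held fixed as $h\to0$. For a time step $\tau>0$ put $c_\tau=\alpha\tau/h$ and $\varepsilon^{(\tau)}=c_\tau-\lfloor c_\tau\rfloor\in[0,1)$. $\mathcal S_p^{(\tau)}\in\mathbb{R}^{n_x\times n_x}$ is the semi-Lagrangian time-stepping operator of odd order $p$: characteristics are traced back from $x_i$ to the departure point $x_i-\alpha\tau$, and the mesh function is evaluated there by degree-$p$ polynomial interpolation using the $p+1$ mesh points nearest to (symmetric about the cell containing) the departure point. Explicitly, with indices modulo $n_x$, $(\mathcal S_p^{(\tau)}v)_i=\sum_{j=-(p+1)/2}^{(p-1)/2}\ell_j(-\varepsilon^{(\tau)})\,v_{i-\lfloor c_\tau\rfloor+j}$, where $\ell_j$ is the Lagrange basis polynomial with $\ell_j(k)=\delta_{jk}$ on the integer nodes $k\in\{-\frac{p+1}2,\dots,\frac{p-1}2\}$. This matrix is circulant; its eigenvalue on the spatial Fourier mode $\chi(\omega)=\exp(\mathrm i\omega x/h)$, $\omega\in[-\pi,\pi)$, is $s_p^{(\tau)}(\omega)=e^{-\mathrm i\omega\lfloor c_\tau\rfloor}\sum_{j}\ell_j(-\varepsilon^{(\tau)})e^{\mathrm i\omega j}$. Let $\lambda(\omega)=s_p^{(\delta t)}(\omega)$ and $\mu(\omega)=s_p^{(m\delta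 t)}(\omega)$ be the eigenvalues of the fine- and coarse-grid time-stepping operators $\Phi$ and $\Psi$. The symbols of the coarse-grid space-time discretization and of the ideal one (with $\Psi$ replaced by $\Phi^m$) are $\widetilde A_1(\omega,m\theta)=1-\mu(\omega)e^{-\mathrm i m\theta}$ and $\widetilde A_1^{\rm ideal}(\omega,m\theta)=1-[\lambda(\omega)]^me^{-\mathrm i m\theta}$, with $\theta\in\Theta^{\rm low}=[-\pi/m,\pi/m)$. Fourier modes of spatial frequency $\omega=\mathcal O(h)$ are called asymptotically smooth. Space-time modes with $\theta\approx-\omega\alpha\delta t/h$ are called characteristic components. Constants in $\mathcal O(\cdot)$ may depend on $p,m,c$ but not on $h,\omega,\theta$. *)

theory Defs
  imports "HOL-Analysis.Analysis"
begin

definition cfl :: "real \<Rightarrow> real \<Rightarrow> real \<Rightarrow> real" where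
  "cfl \<alpha> h \<tau> = \<alpha> * \<tau> / h"

(* For odd p both divisions are exact, giving p + 1 nodes; since eps lies in [0,1), the point
   -eps lies in the middle cell [-1,0] of this stencil. *)
definition sl_nodes :: "nat \<Rightarrow> int set" where
  "sl_nodes p = {- ((int p + 1) div 2) .. (int p - 1) div 2}"

definition lagrange_basis :: "nat \<Rightarrow> int \<Rightarrow> real \<Rightarrow> real" where
  "lagrange_basis p j x =
     (\<Prod>k \<in> sl_nodes p - {j}. (x - of_int k) / (of_int j - of_int k))"

lemma lagrange_basis_node:
  assumes "j \<in> sl_nodes p" "k \<in> sl_nodes p"
  shows "lagrange_basis p j (of_int k) = (if j = k then 1 else 0)"
proof (cases "j = k")
  case True
  have "(\<Prod>i \<in> sl_nodes p - {j}. (of_int j - of_int i) / (of_int j - of_int i) :: real) = 1"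
    by (rule prod.neutral) auto
  with True show ?thesis by (simp add: lagrange_basis_def)
next
  case False
  with assms have "k \<in> sl_nodes p - {j}" by auto
  moreover have "finite (sl_nodes p - {j})" by (simp add: sl_nodes_def)
  ultimately show ?thesis
    using False by (auto simp: lagrange_basis_def intro!: prod_zero bexI[of _ k])
qed

(* The semi-Lagrangian operator S_p on mesh functions v with n spatial points, stored as v 0, ..., v (n-1).
   The value type is generic so that the real operator also acts on complex Fourier modes. *)
definition sl_step ::
  "nat \<Rightarrow> nat \<Rightarrow> real \<Rightarrow> real \<Rightarrow> real \<Rightarrow> (int \<Rightarrow> 'a::real_vector) \<Rightarrow> int \<Rightarrow> 'a" where
  "sl_step n p \<alpha> h \<tau> v i =
     (\<Sum>j \<in> sl_nodes p. lagrange_basis p j (- frac (cfl \<alpha> h \<tau>)) *\<^sub>R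
        v ((i - \<lfloor>cfl \<alpha> h \<tau>\<rfloor> + j) mod int n))"

definition fourier_mode :: "real \<Rightarrow> int \<Rightarrow> complex" where
  "fourier_mode \<omega> i = exp (\<i> * of_real (\<omega> * of_int i))"

definition sl_symbol :: "nat \<Rightarrow> real \<Rightarrow> real \<Rightarrow> real \<Rightarrow> real \<Rightarrow> complex" where
  "sl_symbol p \<alpha> h \<tau> \<omega> =
     exp (- \<i> * of_real (\<omega> * of_int \<lfloor>cfl \<alpha> h \<tau>\<rfloor>)) *
     (\<Sum>j \<in> sl_nodes p. of_real (lagrange_basis p j (- frac (cfl \<alpha> h \<tau>))) *
        exp (\<i> * of_real (\<omega> * of_int j)))"

(* The frequencies representable on the periodic mesh are the integer multiples of 2 pi / n. *)
lemma fourier_mode_mod: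
  assumes "\<omega> * real n = 2 * pi * of_int r"
  shows "fourier_mode \<omega> (i mod int n) = fourier_mode \<omega> i"
proof -
  have i: "i = i mod int n + int n * (i div int n)" by simp
  have "real_of_int i = of_int (i mod int n) + real n * of_int (i div int n)"
    by (subst i) (simp only: of_int_add of_int_mult of_int_of_nat_eq)
  then have "\<omega> * of_int i = \<omega> * of_int (i mod int n) + (\<omega> * real n) * of_int (i div int n)"
    by (simp add: algebra_simps)
  also have "\<dots> = \<omega> * of_int (i mod int n) + of_int (2 * (r * (i div int n))) * pi"
    unfolding assms by simp
  finally have eq: "\<omega> * of_int i = \<omega> * of_int (i mod int n) + of_int (2 * (r * (i div int n))) * pi" .
  show ?thesis
    unfolding fourier_mode_def cis_conv_exp[symmetric] eq
    unfolding cis_mult[symmetric]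
    using cis_multiple_2pi[of "of_int (r * (i div int n))"]
    by (simp add: algebra_simps)
qed

lemma sl_step_fourier_mode:
  assumes "\<omega> * real n = 2 * pi * of_int r"
  shows "sl_step n p \<alpha> h \<tau> (fourier_mode \<omega>) i = sl_symbol p \<alpha> h \<tau> \<omega> * fourier_mode \<omega> i"
proof -
  have "fourier_mode \<omega> (i - a + j) =
      exp (- \<i> * of_real (\<omega> * of_int a)) * exp (\<i> * of_real (\<omega> * of_int j)) * fourier_mode \<omega> i"
    for a j
    unfolding fourier_mode_def exp_add[symmetric] by (simp add: algebra_simps)
  then show ?thesis
    unfolding sl_step_def sl_symbol_def fourier_mode_mod[OF assms]
    by (simp add: sum_distrib_left sum_distrib_right scaleR_conv_of_real mult_ac)
qed

(* In the next two definitions \<phi> is the coarse temporal frequency m * \<theta>. *)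
definition A1_coarse ::
  "nat \<Rightarrow> nat \<Rightarrow> real \<Rightarrow> real \<Rightarrow> real \<Rightarrow> real \<Rightarrow> real \<Rightarrow> complex" where
  "A1_coarse p m \<alpha> h \<delta>t \<omega> \<phi> =
     1 - sl_symbol p \<alpha> h (real m * \<delta>t) \<omega> * exp (- \<i> * of_real \<phi>)"

definition A1_ideal ::
  "nat \<Rightarrow> nat \<Rightarrow> real \<Rightarrow> real \<Rightarrow> real \<Rightarrow> real \<Rightarrow> real \<Rightarrow> complex" where
  "A1_ideal p m \<alpha> h \<delta>t \<omega> \<phi> =
     1 - sl_symbol p \<alpha> h \<delta>t \<omega> ^ m * exp (- \<i> * of_real \<phi>)"

end

theory Submission
  imports Defs
begin

text \<open>
  At fixed CFL number the symbol of a semi-Lagrangian step is, up to the exact phase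
  \<open>exp (- \<i> \<omega> c)\<close>, the degree-\<open>p\<close> interpolant of \<open>y \<mapsto> exp (\<i> \<omega> (y - x))\<close>
  evaluated at the departure point \<open>x = - frac c\<close>. Interpolation is exact up to degree \<open>p\<close>, and its
  error on monic polynomials of degree \<open>p + 1\<close> is the nodal polynomial, so a Taylor expansion gives
  \<open>s(\<omega>) exp (\<i> \<omega> c) = 1 - d \<omega>^(p + 1) + O(\<omega>^(p + 2))\<close>
  (\<open>interpolated_exponential_expansion\<close>). For odd \<open>p\<close> the leading error term is real, and since
  \<open>x\<close> lies strictly inside the central cell of the stencil, \<open>d > 0\<close>
  (\<open>nodal_value_sign\<close>): the scheme is dissipative at exactly the order at which it is accurate.
  This is where a non-integer CFL number enters.

  Hence both \<open>\<mu>\<close> and \<open>\<lambda>^m\<close> are within \<open>O(\<omega>^(p + 1))\<close> of \<open>exp (- \<i> \<omega> m c)\<close>, which bounds the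
  numerator. The denominator \<open>1 - \<mu> exp (- \<i> m \<theta>)\<close> has two lower bounds.
  Dissipation always gives \<open>1 - \<bar>\<mu>\<bar> \<ge> \<nu> \<bar>\<omega>\<bar>^(p + 1)\<close>, of the same order as the numerator,
  so the ratio is bounded. Away from the characteristic components the phase \<open>m (\<theta> + \<omega> c)\<close> keeps
  away from all multiples of \<open>2 \<pi>\<close>, so the denominator is bounded below by a constant and the ratio
  inherits the order of the numerator.
\<close>

section \<open>Lagrange interpolation on the symmetric stencil\<close>

definition nodal_value :: "nat \<Rightarrow> real \<Rightarrow> real" where
  "nodal_value p x = (\<Prod>k \<in> sl_nodes p. x - of_int k)"

lemma finite_sl_nodes [simp]: "finite (sl_nodes p)"
  by (simp add: sl_nodes_def)

lemma card_sl_nodes: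
  assumes "odd p"
  shows "card (sl_nodes p) = p + 1"
  using assms by (auto simp: sl_nodes_def elim!: oddE)

text \<open>
  Adding \<open>coeff q (p + 1)\<close> times the monic nodal polynomial to the interpolant gives a
  polynomial that shares with \<open>q\<close> both the coefficient of degree \<open>p + 1\<close> and the values at the
  \<open>p + 1\<close> nodes, so it is \<open>q\<close>.
\<close>

lemma sl_nodes_interpolation_error:
  fixes q :: "real poly"
  assumes p: "odd p" and deg: "degree q \<le> p + 1"
  shows "(\<Sum>j\<in>sl_nodes p. lagrange_basis p j x * poly q (of_int j)) =
    poly q x - coeff q (p + 1) * nodal_value p x"
proof -
  define L where "L j = (\<Prod>k \<in> sl_nodes p - {j}. smult (1 / (of_int j - of_int k)) [:- of_int k, 1 :: real:])" for j
  define W where "W = (\<Prod>k \<in> sl_nodes p. [:- of_int k, 1 :: real:])"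
  define I where "I = (\<Sum>j\<in>sl_nodes p. smult (poly q (of_int j)) (L j))"
  have poly_L: "poly (L j) y = lagrange_basis p j y" for j y
    by (simp add: L_def lagrange_basis_def poly_prod diff_divide_distrib)
  have poly_W: "poly W y = nodal_value p y" for y
    by (simp add: W_def nodal_value_def poly_prod)
  have deg_W: "degree W = p + 1"
    unfolding W_def by (subst degree_prod_sum_eq) (simp_all add: card_sl_nodes[OF p])
  have lead_W: "coeff W (p + 1) = 1"
    using lead_coeff_prod[of "\<lambda>k. [:- of_int k, 1 :: real:]" "sl_nodes p"]
    by (simp add: deg_W flip: W_def)
  have deg_L: "degree (L j) \<le> p" if "j \<in> sl_nodes p" for j
  proof -
    have "degree (L j) \<le> (\<Sum>k \<in> sl_nodes p - {j}. 1)"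
      unfolding L_def
      by (rule order_trans[OF degree_prod_sum_le]) (auto intro!: sum_mono)
    then show ?thesis
      using that by (simp add: card_sl_nodes[OF p])
  qed
  have deg_I: "degree I \<le> p"
    unfolding I_def by (rule degree_sum_le) (auto intro: order_trans[OF degree_smult_le] deg_L)
  have "I + smult (coeff q (p + 1)) W = q"
  proof (rule poly_eqI_degree_lead_coeff)
    show "coeff (I + smult (coeff q (p + 1)) W) (p + 1) = coeff q (p + 1)"
      using deg_I lead_W by (simp add: coeff_eq_0)
    show "p + 1 \<le> card (of_int ` sl_nodes p :: real set)"
      by (subst card_image) (simp_all add: inj_on_def card_sl_nodes[OF p])
    show "degree (I + smult (coeff q (p + 1)) W) \<le> p + 1"
      using deg_I deg_W by (intro degree_add_le order_trans[OF degree_smult_le]) auto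
    show "degree q \<le> p + 1" by (fact deg)
    fix z :: real
    assume "z \<in> of_int ` sl_nodes p"
    then obtain k where k: "k \<in> sl_nodes p" "z = of_int k" by blast
    have "poly W z = 0"
      using k by (auto simp: poly_W nodal_value_def)
    moreover have "poly I z = poly q z"
      using k by (simp add: I_def poly_sum poly_L lagrange_basis_node if_distrib
          sum.delta cong: if_cong)
    ultimately show "poly (I + smult (coeff q (p + 1)) W) z = poly q z"
      by simp
  qed
  then have "poly q x = poly I x + coeff q (p + 1) * nodal_value p x"
    by (metis poly_W poly_add poly_smult)
  then show ?thesis
    by (simp add: I_def poly_sum poly_L mult.commute)
qed

text \<open>
  The interpolation error of \<open>(y - x) ^ k\<close>, read off at \<open>y = x\<close>. Centring the moments at the
  evaluation point makes all those between the zeroth and the \<open>(p + 1)\<close>-st vanish, so that the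
  Taylor expansion below has just two terms.
\<close>

lemma lagrange_basis_central_moment:
  assumes p: "odd p" and k: "k \<le> p + 1"
  shows "(\<Sum>j\<in>sl_nodes p. lagrange_basis p j x * (of_int j - x) ^ k) =
    (if k = 0 then 1 else if k = p + 1 then - nodal_value p x else 0)"
proof -
  have lead: "coeff ([:- x, 1:] ^ k) k = 1"
    using lead_coeff_power[of "[:- x, 1:]" k] by (simp add: degree_linear_power)
  have "coeff ([:- x, 1:] ^ k) (p + 1) = (if k = p + 1 then 1 else 0)"
    using k lead by (auto simp: coeff_eq_0 degree_linear_power)
  then show ?thesis
    using sl_nodes_interpolation_error[OF p, of "[:- x, 1:] ^ k" x] k
    by (auto simp: degree_linear_power poly_power power_0_left)
qed

text \<open>
  A point of the central cell has half of the \<open>p + 1\<close> nodes on each side, so exactly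
  \<open>(p + 1) div 2\<close> factors of the nodal polynomial are negative there.
\<close>

lemma nodal_value_sign:
  assumes p: "odd p" and x: "- 1 < x" "x < 0"
  shows "0 < (- 1) ^ ((p + 1) div 2) * nodal_value p x"
proof -
  define r where "r = (p + 1) div 2"
  have r: "int p = 2 * int r - 1"
    using p by (auto simp: r_def elim!: oddE)
  have nodes: "sl_nodes p = {- int r..-1} \<union> {0..int r - 1}"
    unfolding sl_nodes_def r by auto
  have "nodal_value p x =
      (\<Prod>k\<in>{- int r..-1}. x - of_int k) * (\<Prod>k\<in>{0..int r - 1}. x - of_int k)"
    unfolding nodal_value_def nodes by (rule prod.union_disjoint) auto
  also have "(\<Prod>k\<in>{0..int r - 1}. x - of_int k) = (\<Prod>k\<in>{0..int r - 1}. - (of_int k - x))"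
    by simp
  also have "\<dots> = (- 1) ^ r * (\<Prod>k\<in>{0..int r - 1}. of_int k - x)"
    by (subst prod_uminus) simp
  finally have "(- 1) ^ r * nodal_value p x =
      (\<Prod>k\<in>{- int r..-1}. x - of_int k) * (\<Prod>k\<in>{0..int r - 1}. of_int k - x)"
    by (simp add: mult.left_commute flip: mult.assoc power_mult_distrib)
  moreover have "0 < (\<Prod>k\<in>{- int r..-1}. x - of_int k)"
  proof (rule prod_pos)
    fix k assume "k \<in> {- int r..-1}"
    then have "real_of_int k \<le> -1" by simp
    then show "0 < x - of_int k" using x by linarith
  qed
  moreover have "0 < (\<Prod>k\<in>{0..int r - 1}. of_int k - x)"
  proof (rule prod_pos)
    fix k assume "k \<in> {0..int r - 1}"
    then have "0 \<le> real_of_int k" by simp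
    then show "0 < of_int k - x" using x by linarith
  qed
  ultimately show ?thesis
    by (simp add: r_def)
qed

section \<open>Expansion of the symbol at low frequency\<close>

text \<open>
  Minus the coefficient of \<open>\<omega> ^ (p + 1)\<close> in the interpolation error. Its sign factor is the value of
  \<open>\<i> ^ (p + 1)\<close> for odd \<open>p\<close>.
\<close>

definition dissipation :: "nat \<Rightarrow> real \<Rightarrow> real" where
  "dissipation p x = (- 1) ^ ((p + 1) div 2) * nodal_value p x / fact (p + 1)"

text \<open>
  Taylor's theorem to order \<open>p + 1\<close>, applied node by node. The moments turn the weighted sum of
  the Taylor polynomials into the two stated terms; the constant \<open>D\<close> collects the remainders.
\<close>

lemma interpolated_exponential_expansion:
  assumes p: "odd p"
  shows "\<exists>D\<ge>0. \<forall>\<omega>.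
    cmod ((\<Sum>j\<in>sl_nodes p. of_real (lagrange_basis p j x) * exp (\<i> * of_real (\<omega> * (of_int j - x))))
      - of_real (1 - dissipation p x * \<omega> ^ (p + 1))) \<le> D * \<bar>\<omega>\<bar> ^ (p + 2)"
proof -
  define l where "l j = lagrange_basis p j x" for j
  define D where "D = (\<Sum>j\<in>sl_nodes p. \<bar>l j\<bar> * (\<bar>of_int j - x\<bar> ^ (p + 2) / fact (p + 1)))"
  have "cmod ((\<Sum>j\<in>sl_nodes p. of_real (l j) * exp (\<i> * of_real (\<omega> * (of_int j - x))))
      - of_real (1 - dissipation p x * \<omega> ^ (p + 1))) \<le> D * \<bar>\<omega>\<bar> ^ (p + 2)" for \<omega>
  proof -
    define y where "y j = \<i> * complex_of_real (\<omega> * (of_int j - x))" for j :: int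
    define T where "T j = (\<Sum>k\<le>p + 1. y j ^ k / fact k)" for j
    have "(\<Sum>j\<in>sl_nodes p. of_real (l j) * T j) =
        (\<Sum>j\<in>sl_nodes p. \<Sum>k\<le>p + 1. (\<i> * \<omega>) ^ k / fact k * of_real (l j * (of_int j - x) ^ k))"
      by (simp add: T_def y_def sum_distrib_left power_mult_distrib mult_ac del: sum.atMost_Suc power_Suc fact_Suc)
    also have "\<dots> = (\<Sum>k\<le>p + 1. (\<i> * \<omega>) ^ k / fact k * of_real (\<Sum>j\<in>sl_nodes p. l j * (of_int j - x) ^ k))"
      by (subst sum.swap) (simp add: sum_distrib_left)
    also have "\<dots> = (\<Sum>k\<le>p + 1. (if k = 0 then 1 else 0) +
        (if k = p + 1 then (\<i> * \<omega>) ^ k / fact k * of_real (- nodal_value p x) else 0))"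
      unfolding l_def by (rule sum.cong) (auto simp: lagrange_basis_central_moment[OF p])
    also have "\<dots> = 1 + (\<i> * \<omega>) ^ (p + 1) / fact (p + 1) * of_real (- nodal_value p x)"
      unfolding sum.distrib by (subst (1 2) sum.delta) auto
    also have "\<dots> = of_real (1 - dissipation p x * \<omega> ^ (p + 1))"
    proof -
      have "\<i> ^ (p + 1) = (\<i> ^ 2) ^ ((p + 1) div 2)"
        unfolding power_mult[symmetric] using p by simp
      then have "\<i> ^ (p + 1) = (- 1) ^ ((p + 1) div 2)" by simp
      then show ?thesis
        unfolding dissipation_def power_mult_distrib by simp
    qed
    finally have main: "(\<Sum>j\<in>sl_nodes p. of_real (l j) * T j) =
      of_real (1 - dissipation p x * \<omega> ^ (p + 1))" .
    have rem: "cmod (exp (y j) - T j) \<le> \<bar>of_int j - x\<bar> ^ (p + 2) / fact (p + 1) * \<bar>\<omega>\<bar> ^ (p + 2)" for j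
    proof -
      have "cmod (exp (y j) - T j) \<le> cmod (y j) ^ (p + 2) / fact (p + 1)"
        using Taylor_exp[of "y j" "p + 1"] by (simp add: T_def y_def)
      also have "cmod (y j) = \<bar>\<omega>\<bar> * \<bar>of_int j - x\<bar>"
        unfolding y_def norm_mult norm_ii norm_of_real abs_mult by simp
      finally show ?thesis
        by (simp only: power_mult_distrib) (simp add: mult_ac)
    qed
    have "cmod ((\<Sum>j\<in>sl_nodes p. of_real (l j) * exp (y j)) - (\<Sum>j\<in>sl_nodes p. of_real (l j) * T j))
        = cmod (\<Sum>j\<in>sl_nodes p. of_real (l j) * (exp (y j) - T j))"
      by (simp add: sum_subtractf right_diff_distrib)
    also have "\<dots> \<le> (\<Sum>j\<in>sl_nodes p. \<bar>l j\<bar> * (\<bar>of_int j - x\<bar> ^ (p + 2) / fact (p + 1) * \<bar>\<omega>\<bar> ^ (p + 2)))"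
      by (intro sum_norm_le) (simp only: norm_mult norm_of_real mult_left_mono[OF rem] abs_ge_zero)
    also have "\<dots> = D * \<bar>\<omega>\<bar> ^ (p + 2)"
      unfolding D_def sum_distrib_right by (simp only: mult.assoc)
    finally show ?thesis
      unfolding main y_def .
  qed
  moreover have "D \<ge> 0"
    unfolding D_def by (intro sum_nonneg) auto
  ultimately show ?thesis
    unfolding l_def by blast
qed

text \<open>
  The integer shift by \<open>\<lfloor>c\<rfloor>\<close> is propagated exactly. Removing the exact phase of the whole step
  therefore leaves only the interpolation, centred at the departure point.
\<close>

lemma sl_symbol_recentred:
  assumes "cfl \<alpha> h \<tau> = c"
  shows "sl_symbol p \<alpha> h \<tau> \<omega> * exp (\<i> * of_real (\<omega> * c)) =
    (\<Sum>j\<in>sl_nodes p. of_real (lagrange_basis p j (- frac c)) *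
       exp (\<i> * of_real (\<omega> * (of_int j - (- frac c)))))"
proof -
  have "exp (- \<i> * of_real (\<omega> * of_int \<lfloor>c\<rfloor>)) * exp (\<i> * of_real (\<omega> * of_int j)) *
      exp (\<i> * of_real (\<omega> * c)) = exp (\<i> * of_real (\<omega> * (of_int j - (- frac c))))" for j
    unfolding exp_add[symmetric] by (simp add: frac_def algebra_simps)
  then show ?thesis
    unfolding sl_symbol_def assms
    by (simp add: sum_distrib_left sum_distrib_right mult.left_commute mult.assoc)
qed

text \<open>
  Accuracy and strict dissipation at the same order. The constants depend only on \<open>p\<close> and the CFL
  number, so they serve all meshes at once; applied with \<open>c\<close> and with \<open>m c\<close>, this is all
  that the coarse-grid estimate needs to know about the scheme.
\<close>

lemma sl_symbol_smooth_modes: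
  assumes p: "odd p" and c: "c \<notin> \<int>"
  shows "\<exists>\<kappa>>0. \<exists>B\<ge>0. \<exists>r>0. \<forall>\<alpha> h \<tau> \<omega>. cfl \<alpha> h \<tau> = c \<longrightarrow> \<bar>\<omega>\<bar> \<le> r \<longrightarrow>
    cmod (sl_symbol p \<alpha> h \<tau> \<omega>) \<le> 1 - \<kappa> * \<bar>\<omega>\<bar> ^ (p + 1) \<and>
    cmod (sl_symbol p \<alpha> h \<tau> \<omega> - exp (- \<i> * of_real (\<omega> * c))) \<le> B * \<bar>\<omega>\<bar> ^ (p + 1)"
proof -
  define x where "x = - frac c"
  have x: "- 1 < x" "x < 0"
    using c frac_lt_1[of c] frac_gt_0_iff[of c] by (auto simp: x_def)
  define d where "d = dissipation p x"
  have d: "d > 0"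
    using nodal_value_sign[OF p x] by (simp add: d_def dissipation_def)
  obtain D where D: "D \<ge> 0" and exp_D: "\<And>\<omega>.
    cmod ((\<Sum>j\<in>sl_nodes p. of_real (lagrange_basis p j x) * exp (\<i> * of_real (\<omega> * (of_int j - x))))
      - of_real (1 - d * \<omega> ^ (p + 1))) \<le> D * \<bar>\<omega>\<bar> ^ (p + 2)"
    using interpolated_exponential_expansion[OF p, of x] unfolding d_def by blast
  \<comment> \<open>These three bounds make \<open>\<bar>\<omega>\<bar>^(p + 1) \<le> \<bar>\<omega>\<bar>\<close>, keep \<open>1 - d \<omega>^(p + 1)\<close> nonnegative,
    and make the remainder at most half of the dissipation.\<close>
  define r where "r = min 1 (min (1 / d) (d / (2 * (D + 1))))"
  have r: "r > 0" using d D by (simp add: r_def)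
  have "cmod (sl_symbol p \<alpha> h \<tau> \<omega>) \<le> 1 - d / 2 * \<bar>\<omega>\<bar> ^ (p + 1) \<and>
      cmod (sl_symbol p \<alpha> h \<tau> \<omega> - exp (- \<i> * of_real (\<omega> * c))) \<le> (d + D) * \<bar>\<omega>\<bar> ^ (p + 1)"
    if cfl: "cfl \<alpha> h \<tau> = c" and \<omega>: "\<bar>\<omega>\<bar> \<le> r" for \<alpha> h \<tau> \<omega>
  proof -
    define s where "s = sl_symbol p \<alpha> h \<tau> \<omega>"
    define e where "e = exp (\<i> * complex_of_real (\<omega> * c))"
    define t where "t = \<bar>\<omega>\<bar> ^ (p + 1)"
    have e: "cmod e = 1" by (simp add: e_def)
    have t: "\<omega> ^ (p + 1) = t" "0 \<le> t"
      unfolding t_def using power_even_abs[of "p + 1" \<omega>] p by (simp, intro zero_le_power abs_ge_zero)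
    have "\<bar>\<omega>\<bar> \<le> 1" using \<omega> by (simp add: r_def)
    then have "t \<le> \<bar>\<omega>\<bar>"
      using power_decreasing[of 1 "p + 1" "\<bar>\<omega>\<bar>"] by (simp add: t_def)
    then have "t \<le> 1 / d" using \<omega> by (simp add: r_def)
    then have dt: "d * t \<le> 1" using d by (simp add: field_simps)
    have "D * \<bar>\<omega>\<bar> \<le> (D + 1) * (d / (2 * (D + 1)))"
      using \<omega> D by (intro mult_mono) (auto simp: r_def)
    also have "\<dots> = d / 2" using D by (simp add: divide_simps)
    finally have D\<omega>: "D * \<bar>\<omega>\<bar> \<le> d / 2" .
    have near: "cmod (s * e - of_real (1 - d * t)) \<le> D * \<bar>\<omega>\<bar> * t"
      using exp_D[of \<omega>] sl_symbol_recentred[OF cfl, of p \<omega>]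
      unfolding s_def e_def t(1) x_def t_def by (simp add: mult_ac)
    have "cmod s = cmod (s * e)" by (simp add: norm_mult e)
    also have "\<dots> \<le> cmod (of_real (1 - d * t)) + cmod (s * e - of_real (1 - d * t))"
      using norm_triangle_sub by blast
    also have "\<dots> \<le> (1 - d * t) + d / 2 * t"
      using near dt mult_right_mono[OF D\<omega> t(2)] by (simp only: norm_of_real)
    finally have A: "cmod s \<le> 1 - d / 2 * t" by simp
    have "s - exp (- \<i> * of_real (\<omega> * c)) = (s * e - 1) * exp (- \<i> * of_real (\<omega> * c))"
      by (simp add: e_def left_diff_distrib mult.assoc flip: exp_add)
    then have "cmod (s - exp (- \<i> * of_real (\<omega> * c))) = cmod (s * e - 1)"
      by (simp add: norm_mult)
    also have "\<dots> = cmod ((s * e - of_real (1 - d * t)) - of_real (d * t))"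
      by simp
    also have "\<dots> \<le> cmod (s * e - of_real (1 - d * t)) + d * t"
      using d t by (intro order_trans[OF norm_triangle_ineq4]) (simp del: of_real_mult)
    also have "\<dots> \<le> D * 1 * t + d * t"
      using near D t(2) \<open>\<bar>\<omega>\<bar> \<le> 1\<close>
      by (intro add_right_mono order_trans[OF near] mult_right_mono mult_left_mono)
    finally show ?thesis
      using A unfolding s_def t_def by (simp add: algebra_simps)
  qed
  then show ?thesis
    using d D r by (intro exI[of _ "d / 2"] exI[of _ "d + D"] exI[of _ r] conjI) auto
qed

section \<open>The coarse-grid correction\<close>

text \<open>
  The distance is \<open>2 \<bar>sin (\<phi> / 2)\<bar>\<close>. The slack beyond \<open>\<pi>\<close> is there because \<open>m \<theta>\<close>
  fills \<open>[- \<pi>, \<pi>)\<close> and the phase is shifted from it by the small quantity \<open>m \<omega> c\<close>; with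
  \<open>d \<le> 1\<close> the reflection \<open>y \<mapsto> \<pi> - y\<close> handles it.
\<close>

lemma dist_one_exp_ge:
  fixes d \<phi> :: real
  assumes d: "0 < d" "d \<le> 1" and \<phi>: "d \<le> \<bar>\<phi>\<bar>" "\<bar>\<phi>\<bar> \<le> pi + 1"
  shows "2 * sin (d / 2) \<le> cmod (1 - exp (- \<i> * of_real \<phi>))"
proof -
  define y where "y = \<bar>\<phi>\<bar> / 2"
  have "sin (d / 2) \<le> sin y"
  proof (cases "y \<le> pi / 2")
    case True
    then show ?thesis
      using d \<phi> pi_gt3 by (intro sin_monotone_2pi_le) (auto simp: y_def)
  next
    case False
    then have "sin (d / 2) \<le> sin (pi - y)"
      using d \<phi> pi_gt3 by (intro sin_monotone_2pi_le) (auto simp: y_def)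
    then show ?thesis by simp
  qed
  also have "sin y \<le> \<bar>sin (\<phi> / 2)\<bar>"
    by (cases "\<phi> \<ge> 0") (auto simp: y_def)
  finally show ?thesis
    using dist_exp_i_1[of "- \<phi>"] by (simp add: norm_minus_commute)
qed

theorem theorem4:
  fixes p m :: nat and c :: real
  assumes "odd p" and "m \<ge> 2" and "c > 0"
    and "c \<notin> \<int>" and "real m * c \<notin> \<int>"
  shows "\<forall>K>0. \<forall>\<delta>>0. \<exists>C>0. \<exists>h0>0.
    \<forall>\<alpha>>0. \<forall>\<delta>t>0. \<forall>h>0. h \<le> h0 \<longrightarrow> cfl \<alpha> h \<delta>t = c \<longrightarrow>
      (\<forall>\<omega>::real. \<forall>\<theta>::real. 0 < \<bar>\<omega>\<bar> \<longrightarrow> \<bar>\<omega>\<bar> \<le> K * h \<longrightarrow> \<theta> \<in> {- pi / real m ..< pi / real m} \<longrightarrow>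
        A1_coarse p m \<alpha> h \<delta>t \<omega> (real m * \<theta>) \<noteq> 0 \<and>
        (\<bar>\<theta> + \<omega> * \<alpha> * \<delta>t / h\<bar> \<ge> \<delta> \<longrightarrow>
           cmod (A1_coarse p m \<alpha> h \<delta>t \<omega> (real m * \<theta>) - A1_ideal p m \<alpha> h \<delta>t \<omega> (real m * \<theta>))
             / cmod (A1_coarse p m \<alpha> h \<delta>t \<omega> (real m * \<theta>)) \<le> C * \<bar>\<omega>\<bar> ^ (p + 1)) \<and>
        (\<bar>\<theta> + \<omega> * \<alpha> * \<delta>t / h\<bar> < \<delta> \<longrightarrow>
           cmod (A1_coarse p m \<alpha> h \<delta>t \<omega> (real m * \<theta>) - A1_ideal p m \<alpha> h \<delta>t \<omega> (real m * \<theta>))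
             / cmod (A1_coarse p m \<alpha> h \<delta>t \<omega> (real m * \<theta>)) \<le> C))"
proof (intro allI impI)
  fix K \<delta> :: real
  assume K: "K > 0" and \<delta>: "\<delta> > 0"
  obtain \<kappa> Bf rf where f: "\<kappa> > 0" "Bf \<ge> 0" "rf > 0"
    and fine: "\<And>\<alpha> h \<tau> \<omega>. cfl \<alpha> h \<tau> = c \<Longrightarrow> \<bar>\<omega>\<bar> \<le> rf \<Longrightarrow>
      cmod (sl_symbol p \<alpha> h \<tau> \<omega>) \<le> 1 - \<kappa> * \<bar>\<omega>\<bar> ^ (p + 1) \<and>
      cmod (sl_symbol p \<alpha> h \<tau> \<omega> - exp (- \<i> * of_real (\<omega> * c))) \<le> Bf * \<bar>\<omega>\<bar> ^ (p + 1)"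
    using sl_symbol_smooth_modes[OF assms(1,4)] by metis
  obtain \<nu> Bc rc where g: "\<nu> > 0" "Bc \<ge> 0" "rc > 0"
    and coarse: "\<And>\<alpha> h \<tau> \<omega>. cfl \<alpha> h \<tau> = real m * c \<Longrightarrow> \<bar>\<omega>\<bar> \<le> rc \<Longrightarrow>
      cmod (sl_symbol p \<alpha> h \<tau> \<omega>) \<le> 1 - \<nu> * \<bar>\<omega>\<bar> ^ (p + 1) \<and>
      cmod (sl_symbol p \<alpha> h \<tau> \<omega> - exp (- \<i> * of_real (\<omega> * (real m * c)))) \<le> Bc * \<bar>\<omega>\<bar> ^ (p + 1)"
    using sl_symbol_smooth_modes[OF assms(1,5)] by metis
  \<comment> \<open>The cap at 1 deals with those \<open>\<delta>\<close> that are too large for non-characteristic components to exist.\<close>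
  define d where "d = min 1 (real m * \<delta>)"
  have d: "0 < d" "d \<le> 1" "d \<le> real m * \<delta>" using \<delta> assms(2) by (auto simp: d_def)
  define \<eta> where "\<eta> = sin (d / 2)"
  have \<eta>: "\<eta> > 0" unfolding \<eta>_def using d pi_gt3 by (intro sin_gt_zero) auto
  \<comment> \<open>The fourth bound keeps the phase shift \<open>m \<omega> c\<close> at most 1; the last makes the error of the
    coarse symbol at most half of the lower bound \<open>2 \<eta>\<close> for the exact phase factor.\<close>
  define r where "r = Min {rf, rc, 1, 1 / (real m * c), \<eta> / (Bc + 1)}"
  have mc: "real m * c > 0" using assms(2,3) by simp
  have r: "r > 0" using f g \<eta> mc by (simp add: r_def)
  define N where "N = Bc + real m * Bf"
  have N: "N \<ge> 0" using f g by (simp add: N_def)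
  define C where "C = N / \<nu> + N / \<eta> + 1"
  have C: "C > 0" "N / \<nu> \<le> C" "N / \<eta> \<le> C"
    using N g \<eta> unfolding C_def by (auto intro: add_nonneg_pos)
  have bound: "A1_coarse p m \<alpha> h \<delta>t \<omega> (real m * \<theta>) \<noteq> 0 \<and>
        (\<bar>\<theta> + \<omega> * \<alpha> * \<delta>t / h\<bar> \<ge> \<delta> \<longrightarrow>
           cmod (A1_coarse p m \<alpha> h \<delta>t \<omega> (real m * \<theta>) - A1_ideal p m \<alpha> h \<delta>t \<omega> (real m * \<theta>))
             / cmod (A1_coarse p m \<alpha> h \<delta>t \<omega> (real m * \<theta>)) \<le> C * \<bar>\<omega>\<bar> ^ (p + 1)) \<and>
        (\<bar>\<theta> + \<omega> * \<alpha> * \<delta>t / h\<bar> < \<delta> \<longrightarrow>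
           cmod (A1_coarse p m \<alpha> h \<delta>t \<omega> (real m * \<theta>) - A1_ideal p m \<alpha> h \<delta>t \<omega> (real m * \<theta>))
             / cmod (A1_coarse p m \<alpha> h \<delta>t \<omega> (real m * \<theta>)) \<le> C)"
    if cfl: "cfl \<alpha> h \<delta>t = c" and \<omega>: "0 < \<bar>\<omega>\<bar>" "\<bar>\<omega>\<bar> \<le> r"
      and \<theta>: "\<theta> \<in> {- pi / real m ..< pi / real m}" for \<alpha> \<delta>t h \<omega> \<theta> :: real
  proof -
    have \<omega>r: "\<bar>\<omega>\<bar> \<le> rf" "\<bar>\<omega>\<bar> \<le> rc" "\<bar>\<omega>\<bar> \<le> 1" "\<bar>\<omega>\<bar> \<le> 1 / (real m * c)" "\<bar>\<omega>\<bar> \<le> \<eta> / (Bc + 1)"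
      using \<omega>(2) by (auto simp: r_def)
    define l where "l = sl_symbol p \<alpha> h \<delta>t \<omega>"
    define u where "u = sl_symbol p \<alpha> h (real m * \<delta>t) \<omega>"
    define t where "t = \<bar>\<omega>\<bar> ^ (p + 1)"
    define E where "E = exp (- \<i> * complex_of_real (real m * \<theta>))"
    define a where "a = exp (- \<i> * complex_of_real (\<omega> * c))"
    have t: "t > 0" using \<omega>(1) by (simp add: t_def)
    have "t \<le> \<bar>\<omega>\<bar>"
      using \<omega>r(3) power_decreasing[of 1 "p + 1" "\<bar>\<omega>\<bar>"] by (simp add: t_def)
    have E: "cmod E = 1" by (simp add: E_def)
    have a: "cmod a = 1" by (simp add: a_def)
    have am: "a ^ m = exp (- \<i> * complex_of_real (\<omega> * (real m * c)))"
      unfolding a_def exp_of_nat_mult[symmetric] by (simp add: mult_ac)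
    have cfl_coarse: "cfl \<alpha> h (real m * \<delta>t) = real m * c"
      unfolding cfl[symmetric] by (simp add: cfl_def)
    have l: "cmod l \<le> 1 - \<kappa> * t" "cmod (l - a) \<le> Bf * t"
      using fine[OF cfl \<omega>r(1)] by (simp_all add: l_def t_def a_def)
    have u: "cmod u \<le> 1 - \<nu> * t" "cmod (u - a ^ m) \<le> Bc * t"
      using coarse[OF cfl_coarse \<omega>r(2)] unfolding u_def t_def am by simp_all
    have "cmod l \<le> 1" using l(1) f t by (smt (verit) mult_pos_pos)
    then have "cmod (l ^ m - a ^ m) \<le> real m * cmod (l - a)"
      using a by (intro norm_power_diff) auto
    also have "\<dots> \<le> real m * (Bf * t)" by (intro mult_left_mono l) auto
    finally have "cmod (u - l ^ m) \<le> Bc * t + real m * (Bf * t)"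
      using u(2) norm_triangle_ineq4[of "u - a ^ m" "l ^ m - a ^ m"] by simp
    then have num: "cmod (u - l ^ m) \<le> N * t"
      by (simp add: N_def algebra_simps)
    have A: "A1_coarse p m \<alpha> h \<delta>t \<omega> (real m * \<theta>) = 1 - u * E"
      by (simp add: A1_coarse_def u_def E_def)
    have "A1_coarse p m \<alpha> h \<delta>t \<omega> (real m * \<theta>) - A1_ideal p m \<alpha> h \<delta>t \<omega> (real m * \<theta>) = - ((u - l ^ m) * E)"
      by (simp add: A1_coarse_def A1_ideal_def u_def l_def E_def algebra_simps)
    then have diff: "cmod (A1_coarse p m \<alpha> h \<delta>t \<omega> (real m * \<theta>) - A1_ideal p m \<alpha> h \<delta>t \<omega> (real m * \<theta>)) \<le> N * t"
      using num by (simp add: norm_mult E)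
    \<comment> \<open>Dissipation alone, valid for every \<open>\<theta>\<close>.\<close>
    have den: "\<nu> * t \<le> cmod (1 - u * E)"
      using norm_triangle_ineq2[of 1 "u * E"] u(1) by (simp add: norm_mult E)
    have \<nu>t: "0 < \<nu> * t" using g t by simp
    have "A1_coarse p m \<alpha> h \<delta>t \<omega> (real m * \<theta>) \<noteq> 0"
      using den \<nu>t unfolding A by force
    moreover have "cmod (A1_coarse p m \<alpha> h \<delta>t \<omega> (real m * \<theta>) - A1_ideal p m \<alpha> h \<delta>t \<omega> (real m * \<theta>))
             / cmod (A1_coarse p m \<alpha> h \<delta>t \<omega> (real m * \<theta>)) \<le> C"
    proof -
      have "cmod (A1_coarse p m \<alpha> h \<delta>t \<omega> (real m * \<theta>) - A1_ideal p m \<alpha> h \<delta>t \<omega> (real m * \<theta>))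
             / cmod (A1_coarse p m \<alpha> h \<delta>t \<omega> (real m * \<theta>)) \<le> (N * t) / (\<nu> * t)"
        using diff den \<nu>t N t unfolding A by (intro frac_le) auto
      also have "\<dots> = N / \<nu>" using t by simp
      finally show ?thesis using C by linarith
    qed
    moreover have "cmod (A1_coarse p m \<alpha> h \<delta>t \<omega> (real m * \<theta>) - A1_ideal p m \<alpha> h \<delta>t \<omega> (real m * \<theta>))
             / cmod (A1_coarse p m \<alpha> h \<delta>t \<omega> (real m * \<theta>)) \<le> C * \<bar>\<omega>\<bar> ^ (p + 1)"
      if far: "\<bar>\<theta> + \<omega> * \<alpha> * \<delta>t / h\<bar> \<ge> \<delta>"
    proof -
      define \<phi> where "\<phi> = real m * (\<theta> + \<omega> * c)"
      have m0: "real m > 0" using assms(2) by simp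
      have "\<omega> * \<alpha> * \<delta>t / h = \<omega> * c" using cfl by (simp add: cfl_def mult_ac flip: cfl)
      then have "\<delta> \<le> \<bar>\<theta> + \<omega> * c\<bar>" using far by simp
      then have lo: "d \<le> \<bar>\<phi>\<bar>"
        using d(3) m0 unfolding \<phi>_def abs_mult by (smt (verit) mult_left_mono abs_of_pos)
      have "\<bar>real m * \<theta>\<bar> \<le> pi"
        using \<theta> m0 by (auto simp: abs_le_iff field_simps)
      moreover have "\<bar>real m * (\<omega> * c)\<bar> \<le> 1"
      proof -
        have "\<bar>real m * (\<omega> * c)\<bar> = \<bar>\<omega>\<bar> * (real m * c)"
          using assms(3) by (simp add: abs_mult)
        also have "\<dots> \<le> 1" using \<omega>r(4) mc by (simp only: pos_le_divide_eq)
        finally show ?thesis .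
      qed
      ultimately have hi: "\<bar>\<phi>\<bar> \<le> pi + 1"
        unfolding \<phi>_def distrib_left by linarith
      have aE: "a ^ m * E = exp (- \<i> * of_real \<phi>)"
        unfolding am E_def \<phi>_def exp_add[symmetric] by (simp add: algebra_simps)
      \<comment> \<open>Compare with the symbol of exact advection.\<close>
      have "2 * \<eta> \<le> cmod (1 - a ^ m * E)"
        unfolding aE \<eta>_def by (rule dist_one_exp_ge[OF d(1,2) lo hi])
      also have "\<dots> = cmod ((1 - u * E) + (u - a ^ m) * E)" by (simp add: algebra_simps)
      also have "\<dots> \<le> cmod (1 - u * E) + cmod ((u - a ^ m) * E)" by (rule norm_triangle_ineq)
      also have "cmod ((u - a ^ m) * E) \<le> Bc * t" using u(2) by (simp add: norm_mult E)
      also have "Bc * t \<le> (Bc + 1) * (\<eta> / (Bc + 1))"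
        using \<open>t \<le> \<bar>\<omega>\<bar>\<close> \<omega>r(5) g t by (intro mult_mono) auto
      also have "\<dots> = \<eta>" using g by simp
      finally have den': "\<eta> \<le> cmod (1 - u * E)" by simp
      have "cmod (A1_coarse p m \<alpha> h \<delta>t \<omega> (real m * \<theta>) - A1_ideal p m \<alpha> h \<delta>t \<omega> (real m * \<theta>))
             / cmod (A1_coarse p m \<alpha> h \<delta>t \<omega> (real m * \<theta>)) \<le> (N * t) / \<eta>"
        using diff den' \<eta> N t unfolding A by (intro frac_le) auto
      also have "\<dots> \<le> C * t"
        using mult_right_mono[OF C(3), of t] t by simp
      finally show ?thesis by (simp add: t_def)
    qed
    ultimately show ?thesis by blast
  qed
  show "\<exists>C>0. \<exists>h0>0.
    \<forall>\<alpha>>0. \<forall>\<delta>t>0. \<forall>h>0. h \<le> h0 \<longrightarrow> cfl \<alpha> h \<delta>t = c \<longrightarrow>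
      (\<forall>\<omega>::real. \<forall>\<theta>::real. 0 < \<bar>\<omega>\<bar> \<longrightarrow> \<bar>\<omega>\<bar> \<le> K * h \<longrightarrow> \<theta> \<in> {- pi / real m ..< pi / real m} \<longrightarrow>
        A1_coarse p m \<alpha> h \<delta>t \<omega> (real m * \<theta>) \<noteq> 0 \<and>
        (\<bar>\<theta> + \<omega> * \<alpha> * \<delta>t / h\<bar> \<ge> \<delta> \<longrightarrow>
           cmod (A1_coarse p m \<alpha> h \<delta>t \<omega> (real m * \<theta>) - A1_ideal p m \<alpha> h \<delta>t \<omega> (real m * \<theta>))
             / cmod (A1_coarse p m \<alpha> h \<delta>t \<omega> (real m * \<theta>)) \<le> C * \<bar>\<omega>\<bar> ^ (p + 1)) \<and>
        (\<bar>\<theta> + \<omega> * \<alpha> * \<delta>t / h\<bar> < \<delta> \<longrightarrow>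
           cmod (A1_coarse p m \<alpha> h \<delta>t \<omega> (real m * \<theta>) - A1_ideal p m \<alpha> h \<delta>t \<omega> (real m * \<theta>))
             / cmod (A1_coarse p m \<alpha> h \<delta>t \<omega> (real m * \<theta>)) \<le> C))"
  proof (rule exI[of _ C], rule conjI[OF C(1)], rule exI[of _ "r / K"], rule conjI)
    show "0 < r / K" using r K by simp
    have "\<bar>\<omega>\<bar> \<le> r" if "h \<le> r / K" "\<bar>\<omega>\<bar> \<le> K * h" for h \<omega> :: real
      using that K by (simp add: field_simps)
    then show "\<forall>\<alpha>>0. \<forall>\<delta>t>0. \<forall>h>0. h \<le> r / K \<longrightarrow> cfl \<alpha> h \<delta>t = c \<longrightarrow>
      (\<forall>\<omega>::real. \<forall>\<theta>::real. 0 < \<bar>\<omega>\<bar> \<longrightarrow> \<bar>\<omega>\<bar> \<le> K * h \<longrightarrow> \<theta> \<in> {- pi / real m ..< pi / real m} \<longrightarrow>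
        A1_coarse p m \<alpha> h \<delta>t \<omega> (real m * \<theta>) \<noteq> 0 \<and>
        (\<bar>\<theta> + \<omega> * \<alpha> * \<delta>t / h\<bar> \<ge> \<delta> \<longrightarrow>
           cmod (A1_coarse p m \<alpha> h \<delta>t \<omega> (real m * \<theta>) - A1_ideal p m \<alpha> h \<delta>t \<omega> (real m * \<theta>))
             / cmod (A1_coarse p m \<alpha> h \<delta>t \<omega> (real m * \<theta>)) \<le> C * \<bar>\<omega>\<bar> ^ (p + 1)) \<and>
        (\<bar>\<theta> + \<omega> * \<alpha> * \<delta>t / h\<bar> < \<delta> \<longrightarrow>
           cmod (A1_coarse p m \<alpha> h \<delta>t \<omega> (real m * \<theta>) - A1_ideal p m \<alpha> h \<delta>t \<omega> (real m * \<theta>))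
             / cmod (A1_coarse p m \<alpha> h \<delta>t \<omega> (real m * \<theta>)) \<le> C))"
      using bound by blast
  qed
qed

end
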